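(* Let $\Theta\subseteq\mathbb{R}$, let $\theta^*\in\mathbb{R}$, let $H_0=\{\theta\in\Theta:\theta\le\theta^*\}$ and $H_1=\Theta\setminus H_0$. Assume: (1) for every $\theta\in\Theta$, $\mathbb{P}_\theta$ is absolutely continuous with respect to the Lebesgue measure $\lambda$ and $f_\theta(x):=\frac{d\mathbb{P}_\theta}{d\lambda}(x)>0$; (2) there exists a (real-valued) sufficient statistic $T$ for $\theta$ and the likelihood is monotone over $T$. Let $\alpha,\beta\in[0,1]$, let $c_0\in\mathbb{R}$ be such that $\sup_{\theta_1\in H_1}\mathbb{P}_{\theta_1}(T(X)\le c_0)=\beta$, and let $c_1\in\mathbb{R}$ be such that $\sup_{\theta_0\in H_0}\mathbb{P}_{\theta_0}(T(X)>c_1)=\alpha$. Then: 1. If $c_0\le c_1$, then $\phi_{T,c_0,c_1}$ is a uniformly most powerful (UMP) agnostic test, that is, it has $(\alpha,\beta)$-level and $\phi_{T,c_0,c_1}\succeq\phi$ for every $(\alpha,\beta)$-size agnostic test $\phi$. 2. If $c_0>c_1$, let $\Phi=\{\phi_{T,c,c}:c_1\le c\le c_0\}$. Then for every $(\alpha,\beta)$-size agnostic test $\phi$ there exists $\phi^*\in\Phi$ such that $\phi^*\succeq\phi$.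
   Context: Setting: $X$ is the data, taking values in the sample space $\mathcal{X}$; $\mathbb{P}_\theta$ is the distribution of $X$ on $\mathcal{X}$ when the parameter is $\theta\in\Theta$. The null hypothesis $H_0$ is identified with a subset of $\Theta$ and the alternative is $H_1=\Theta\setminus H_0$. An agnostic test is a function $\phi:\mathcal{X}\to\{0,\tfrac12,1\}$ ($0$ = accept $H_0$, $1$ = reject $H_0$, $\tfrac12$ = remain agnostic); $\mathbb{P}_\theta(\phi=i)$ means $\mathbb{P}_\theta(\phi(X)=i)$. Put $\alpha_\phi:=\sup_{\theta_0\in H_0}\mathbb{P}_{\theta_0}(\phi=1)$ and $\beta_\phi:=\sup_{\theta_1\in H_1}\mathbb{P}_{\theta_1}(\phi=0)$. The test $\phi$ has $(\alpha,\beta)$-level if $\alpha_\phi=\alpha$ and $\beta_\phi=\beta$; it has $(\alpha,\beta)$-size if $\alpha_\phi\le\alpha$ and $\beta_\phi\le\beta$. The power function is $\pi_\phi(\theta)=\mathbb{P}_\theta(\phi=0)$ for $\theta\in H_0$ and $\pi_\phi(\theta)=\mathbb{P}_\theta(\phi=1)$ for $\theta\in H_1$. Write $\phi_1\succeq\phi_2$ if $\pi_{\phi_1}(\theta)\ge\pi_{\phi_2}(\theta)$ for every $\theta\in\Theta$. For a statistic $T$ and $c_0\le c_1$, $\phi_{T,c_0,c_1}(x)=0$ if $T(x)\le c_0$, $=1$ if $T(x)>c_1$, and $=\tfrac12$ otherwise. "The likelihood is monotone over $T$" means monotone likelihood ratio: for $\theta_1<\theta_2$ in $\Theta$, $f_{\theta_2}(x)/f_{\theta_1}(x)$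 is a nondecreasing function of $T(x)$.
   Formalization: Part 2 is false when T(X) has an atom in (c_1,c_0], which absolute continuity of X does not rule out; it is proved under the added assumption that P_θ(T(X)=t)=0 for every θ in Θ and every real t. Part 1 is proved as stated. *)

theory Defs
  imports "HOL-Probability.Probability"
begin

text \<open>
  Throughout, \<open>P \<theta>\<close> is the distribution of the data under the parameter \<open>\<theta>\<close> and
  \<open>M\<close> is the reference measure, whose space is the sample space and whose
  measurable sets are those of every \<open>P \<theta>\<close>.
\<close>

section \<open>Agnostic tests\<close>

text \<open>Values: 0 accepts the null hypothesis, 1 rejects it, 1/2 is agnostic.\<close>

definition agnostic_test :: "'a measure \<Rightarrow> ('a \<Rightarrow> real) \<Rightarrow> bool" where
  "agnostic_test M \<phi> \<longleftrightarrow>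
     \<phi> \<in> borel_measurable M \<and> (\<forall>x\<in>space M. \<phi> x \<in> {0, 1/2, 1})"

definition prob_decision :: "'a measure \<Rightarrow> ('a \<Rightarrow> real) \<Rightarrow> real \<Rightarrow> real" where
  "prob_decision N \<phi> i = measure N {x \<in> space N. \<phi> x = i}"

text \<open>
  Suprema are taken in the extended reals, so the supremum over an empty hypothesis
  is \<open>-\<infinity>\<close>; in particular it is never equal to a level in \<open>[0,1]\<close>. Over a
  nonempty hypothesis they are the usual suprema in \<open>[0,1]\<close>.
\<close>

definition type1_error :: "(real \<Rightarrow> 'a measure) \<Rightarrow> real set \<Rightarrow> ('a \<Rightarrow> real) \<Rightarrow> ereal" where
  "type1_error P H0 \<phi> = (SUP \<theta>\<in>H0. ereal (prob_decision (P \<theta>) \<phi> 1))"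

definition type2_error :: "(real \<Rightarrow> 'a measure) \<Rightarrow> real set \<Rightarrow> ('a \<Rightarrow> real) \<Rightarrow> ereal" where
  "type2_error P H1 \<phi> = (SUP \<theta>\<in>H1. ereal (prob_decision (P \<theta>) \<phi> 0))"

text \<open>Here ``level'' means equality and ``size'' means inequality.\<close>

definition has_level ::
  "(real \<Rightarrow> 'a measure) \<Rightarrow> real set \<Rightarrow> real set \<Rightarrow> real \<Rightarrow> real \<Rightarrow> ('a \<Rightarrow> real) \<Rightarrow> bool" where
  "has_level P H0 H1 \<alpha> \<beta> \<phi> \<longleftrightarrow>
     type1_error P H0 \<phi> = ereal \<alpha> \<and> type2_error P H1 \<phi> = ereal \<beta>"

definition has_size ::
  "(real \<Rightarrow> 'a measure) \<Rightarrow> real set \<Rightarrow> real set \<Rightarrow> real \<Rightarrow> real \<Rightarrow> ('a \<Rightarrow> real) \<Rightarrow> bool" where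
  "has_size P H0 H1 \<alpha> \<beta> \<phi> \<longleftrightarrow>
     type1_error P H0 \<phi> \<le> ereal \<alpha> \<and> type2_error P H1 \<phi> \<le> ereal \<beta>"

definition power_fun ::
  "(real \<Rightarrow> 'a measure) \<Rightarrow> real set \<Rightarrow> ('a \<Rightarrow> real) \<Rightarrow> real \<Rightarrow> real" where
  "power_fun P H0 \<phi> \<theta> =
     (if \<theta> \<in> H0 then prob_decision (P \<theta>) \<phi> 0 else prob_decision (P \<theta>) \<phi> 1)"

definition dominates ::
  "(real \<Rightarrow> 'a measure) \<Rightarrow> real set \<Rightarrow> real set \<Rightarrow> ('a \<Rightarrow> real) \<Rightarrow> ('a \<Rightarrow> real) \<Rightarrow> bool" where
  "dominates P H0 H1 \<phi>1 \<phi>2 \<longleftrightarrow>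
     (\<forall>\<theta>\<in>H0 \<union> H1. power_fun P H0 \<phi>1 \<theta> \<ge> power_fun P H0 \<phi>2 \<theta>)"

definition UMP_agnostic_test ::
  "'a measure \<Rightarrow> (real \<Rightarrow> 'a measure) \<Rightarrow> real set \<Rightarrow> real set \<Rightarrow> real \<Rightarrow> real \<Rightarrow>
     ('a \<Rightarrow> real) \<Rightarrow> bool" where
  "UMP_agnostic_test M P H0 H1 \<alpha> \<beta> \<phi> \<longleftrightarrow>
     agnostic_test M \<phi> \<and> has_level P H0 H1 \<alpha> \<beta> \<phi> \<and>
     (\<forall>\<psi>. agnostic_test M \<psi> \<and> has_size P H0 H1 \<alpha> \<beta> \<psi> \<longrightarrow> dominates P H0 H1 \<phi> \<psi>)"

definition cutoff_test :: "('a \<Rightarrow> real) \<Rightarrow> real \<Rightarrow> real \<Rightarrow> 'a \<Rightarrow> real" where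
  "cutoff_test T c0 c1 x = (if T x \<le> c0 then 0 else if T x > c1 then 1 else 1/2)"

section \<open>Statistics\<close>

text \<open>
  Sufficiency: the conditional distribution of the data given \<open>T\<close> does not depend on
  the parameter, i.e. each measurable \<open>A\<close> has a common version \<open>h \<circ> T\<close> of the
  conditional probabilities of \<open>A\<close> given the sigma-algebra generated by \<open>T\<close>.
\<close>

definition sufficient_statistic ::
  "'a measure \<Rightarrow> (real \<Rightarrow> 'a measure) \<Rightarrow> real set \<Rightarrow> ('a \<Rightarrow> real) \<Rightarrow> bool" where
  "sufficient_statistic M P \<Theta> T \<longleftrightarrow>
     T \<in> borel_measurable M \<and>
     (\<forall>A\<in>sets M. \<exists>h :: real \<Rightarrow> real. h \<in> borel_measurable borel \<and>
        (\<forall>\<theta>\<in>\<Theta>. AE x in P \<theta>.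
           real_cond_exp (P \<theta>) (vimage_algebra (space M) T borel) (indicator A) x = h (T x)))"

definition monotone_likelihood_ratio ::
  "'a set \<Rightarrow> (real \<Rightarrow> 'a \<Rightarrow> real) \<Rightarrow> real set \<Rightarrow> ('a \<Rightarrow> real) \<Rightarrow> bool" where
  "monotone_likelihood_ratio S f \<Theta> T \<longleftrightarrow>
     (\<forall>\<theta>1\<in>\<Theta>. \<forall>\<theta>2\<in>\<Theta>. \<theta>1 < \<theta>2 \<longrightarrow>
        (\<exists>g :: real \<Rightarrow> real. mono_on (T ` S) g \<and> (\<forall>x\<in>S. f \<theta>2 x / f \<theta>1 x = g (T x))))"

text \<open>
  An absolutely continuous distribution of the data does not force that of \<open>T\<close> to be
  atomless. Let \<open>T\<close> be the ceiling on the sample space \<open>(0,3]\<close>, with densities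
  1/2, 1/3, 1/6 under the null parameter and 1/6, 1/3, 1/2 under the alternative one on the
  three unit intervals; take cutoffs \<open>c\<^sub>0 = 2\<close> and \<open>c\<^sub>1 = 1\<close>, so
  \<open>\<alpha> = \<beta> = 1/2\<close>. Accepting on \<open>(0,3/2]\<close> and rejecting on \<open>(3/2,3]\<close>
  has both errors 1/3 and power 2/3 at both parameters, whereas each \<open>T \<le> c\<close> versus
  \<open>T > c\<close> test with \<open>1 \<le> c \<le> 2\<close> has power 1/2 at one of them. So domination
  by single-cutoff tests needs the following condition.
\<close>

definition continuously_distributed ::
  "(real \<Rightarrow> 'a measure) \<Rightarrow> real set \<Rightarrow> ('a \<Rightarrow> real) \<Rightarrow> bool" where
  "continuously_distributed P \<Theta> T \<longleftrightarrow>
     (\<forall>\<theta>\<in>\<Theta>. \<forall>t. measure (P \<theta>) {x \<in> space (P \<theta>). T x = t} = 0)"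

end

(* Fix densities f, g and a region B on which the ratio g/f is at most some k, while g/f is at
   least k off B.  The Neyman-Pearson argument shows that a region A which beats B under f by
   d > 0 satisfies G(A) >= G(B) + k d >= G(B) (1 + d), because G(B) <= k F(B) <= k.  The bound is
   multiplicative with a factor independent of g, so it survives the supremum over a composite
   hypothesis even if that supremum is not attained; this gives the first part.

   If c1 < c0, consider the cutoffs c for which {T <= c} is at least as probable as the acceptance
   region under all null parameters, and those for which {T > c} is at least as probable as the
   rejection region under all alternative ones.  Both sets are closed because T is atomless, they
   meet [c1,c0], and by the same inequality they cover the line.  As [c1,c0] is connected, some
   cutoff in it lies in both sets. *)

theory Submission
  imports Defs
begin

section \<open>Measures given by densities\<close>

lemma measure_density_le_mult:
  fixes M :: "'a measure" and f g :: "'a \<Rightarrow> real"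
  assumes f: "f \<in> borel_measurable M" and g: "g \<in> borel_measurable M"
    and F: "finite_measure (density M (\<lambda>x. ennreal (f x)))"
    and X: "X \<in> sets M" and k: "0 \<le> k"
    and le: "\<And>x. x \<in> X \<Longrightarrow> g x \<le> k * f x"
  shows "measure (density M (\<lambda>x. ennreal (g x))) X
       \<le> k * measure (density M (\<lambda>x. ennreal (f x))) X"
proof -
  interpret F: finite_measure "density M (\<lambda>x. ennreal (f x))" by fact
  have "emeasure (density M (\<lambda>x. ennreal (g x))) X = (\<integral>\<^sup>+x. ennreal (g x) * indicator X x \<partial>M)"
    using g X by (subst emeasure_density) auto
  also have "\<dots> \<le> (\<integral>\<^sup>+x. ennreal k * (ennreal (f x) * indicator X x) \<partial>M)"
    using le k by (intro nn_integral_mono) (auto split: split_indicator simp: ennreal_mult'[symmetric] intro!: ennreal_leI)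
  also have "\<dots> = ennreal k * (\<integral>\<^sup>+x. ennreal (f x) * indicator X x \<partial>M)"
    using f X by (intro nn_integral_cmult) auto
  also have "\<dots> = ennreal k * emeasure (density M (\<lambda>x. ennreal (f x))) X"
    using f X by (subst emeasure_density) auto
  also have "\<dots> = ennreal (k * measure (density M (\<lambda>x. ennreal (f x))) X)"
    using k by (simp add: F.emeasure_eq_measure ennreal_mult')
  \<comment> \<open>Finiteness of the \<open>f\<close>-measure makes the right side a genuine real
    bound, so \<open>X\<close> has finite mass under the density \<open>g\<close> as well and
    \<open>measure\<close> does not default to 0.\<close>
  finally show ?thesis
    using k unfolding measure_def[of "density M (\<lambda>x. ennreal (g x))"]
    by (intro enn2real_leI) (auto simp: measure_nonneg)
qed

text \<open>A positive density has the same null sets as \<open>M\<close>. All members of the family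
  therefore share their null sets, which is how nullity of a region is carried from one parameter to
  another.\<close>

lemma measure_density_eq_0_iff:
  fixes f :: "'a \<Rightarrow> real"
  assumes f: "f \<in> borel_measurable M" and pos: "\<And>x. x \<in> space M \<Longrightarrow> 0 < f x"
    and F: "finite_measure (density M (\<lambda>x. ennreal (f x)))"
    and X: "X \<in> sets M"
  shows "measure (density M (\<lambda>x. ennreal (f x))) X = 0 \<longleftrightarrow> X \<in> null_sets M"
proof -
  interpret F: finite_measure "density M (\<lambda>x. ennreal (f x))" by fact
  have "measure (density M (\<lambda>x. ennreal (f x))) X = 0
      \<longleftrightarrow> X \<in> null_sets (density M (\<lambda>x. ennreal (f x)))"
    using X by (simp add: null_sets_def F.emeasure_eq_measure)
  also have "\<dots> \<longleftrightarrow> (AE x in M. x \<in> X \<longrightarrow> ennreal (f x) = 0)"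
    using f X by (subst null_sets_density_iff) auto
  also have "\<dots> \<longleftrightarrow> (AE x in M. x \<notin> X)"
    using pos by (intro AE_cong) (auto simp: ennreal_eq_0_iff not_le[symmetric])
  also have "\<dots> \<longleftrightarrow> X \<in> null_sets M"
    using X by (simp add: AE_iff_null_sets)
  finally show ?thesis .
qed

text \<open>Separation by a threshold k gives G(A) - G(B) = G(A-B) - G(B-A) \<ge> k (F(A) - F(B)).
  Neither \<open>sep\<close> nor the conclusion mentions k, so one \<open>B\<close> can serve a
  whole family of \<open>g\<close> although k varies with \<open>g\<close>.\<close>

lemma neyman_pearson_mult:
  fixes M :: "'a measure" and f g :: "'a \<Rightarrow> real"
  defines "F \<equiv> density M (\<lambda>x. ennreal (f x))" and "G \<equiv> density M (\<lambda>x. ennreal (g x))"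
  assumes f: "f \<in> borel_measurable M" and g: "g \<in> borel_measurable M"
    and fpos: "\<And>x. x \<in> space M \<Longrightarrow> 0 < f x" and gpos: "\<And>x. x \<in> space M \<Longrightarrow> 0 < g x"
    and F: "prob_space F" and G: "prob_space G"
    and A: "A \<in> sets M" and B: "B \<in> sets M"
    and sep: "\<And>x y. x \<in> B \<Longrightarrow> y \<in> space M - B \<Longrightarrow> g x / f x \<le> g y / f y"
    and less: "measure F B < measure F A"
  shows "measure G B * (1 + (measure F A - measure F B)) \<le> measure G A"
proof (cases "B = {}")
  case True
  then show ?thesis by simp
next
  case False
  interpret F: prob_space F by fact
  interpret G: prob_space G by fact
  have [simp]: "sets F = sets M" "sets G = sets M" "space F = space M" "space G = space M"
    by (simp_all add: F_def G_def)
  have BS: "B \<subseteq> space M" using B sets.sets_into_space by blast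
  have AS: "A \<subseteq> space M" using A sets.sets_into_space by blast
  \<comment> \<open>A point outside \<open>B\<close> is needed because its ratio bounds the ratios
    on \<open>B\<close>, which makes the supremum below meaningful.\<close>
  have "B \<noteq> space M"
  proof
    assume "B = space M"
    then have "measure F B = 1" using F.prob_space by simp
    with less F.prob_le_1[of A] show False by simp
  qed
  with BS obtain y where y: "y \<in> space M - B" by blast
  from False obtain x0 where x0: "x0 \<in> B" by blast
  \<comment> \<open>As the least upper bound of the ratios on \<open>B\<close>, k lies below every
    ratio off \<open>B\<close>, by \<open>sep\<close>.\<close>
  define k where "k = (SUP x\<in>B. g x / f x)"
  have bdd: "bdd_above ((\<lambda>x. g x / f x) ` B)" using sep y by (auto intro!: bdd_aboveI2)
  have on_B: "g x / f x \<le> k" if "x \<in> B" for x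
    unfolding k_def using that bdd by (rule cSUP_upper)
  have off_B: "k \<le> g x / f x" if "x \<in> space M - B" for x
    unfolding k_def using False sep that by (intro cSUP_least) auto
  have "0 < g x0 / f x0" using x0 BS fpos gpos by (auto intro!: divide_pos_pos)
  with on_B[OF x0] have k: "0 < k" by simp
  have GF: "measure G X \<le> k * measure F X" if "X \<in> sets M" "X \<subseteq> B" for X
    unfolding F_def G_def
  proof (rule measure_density_le_mult)
    show "finite_measure (density M (\<lambda>x. ennreal (f x)))"
      using F.finite_measure_axioms by (simp add: F_def)
    show "g x \<le> k * f x" if "x \<in> X" for x
    proof -
      have "x \<in> B" using that \<open>X \<subseteq> B\<close> by auto
      then show ?thesis using on_B[of x] fpos[of x] BS by (auto simp: field_simps)
    qed
  qed (use f g k that in auto)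
  have FG: "k * measure F X \<le> measure G X" if "X \<in> sets M" "X \<inter> B = {}" for X
  proof -
    have "measure F X \<le> (1 / k) * measure G X"
      unfolding F_def G_def
    proof (rule measure_density_le_mult)
      show "finite_measure (density M (\<lambda>x. ennreal (g x)))"
        using G.finite_measure_axioms by (simp add: G_def)
      show "f x \<le> 1 / k * g x" if "x \<in> X" for x
      proof -
        have "x \<in> space M - B"
          using that \<open>X \<inter> B = {}\<close> sets.sets_into_space[OF \<open>X \<in> sets M\<close>] by auto
        then show ?thesis using off_B[of x] fpos[of x] k by (auto simp: field_simps)
      qed
    qed (use f g k that in auto)
    then show ?thesis using k by (simp add: field_simps)
  qed
  have split: "measure N X = measure N (X \<inter> Y) + measure N (X - Y)"
    if "finite_measure N" "sets N = sets M" "X \<in> sets M" "Y \<in> sets M" for N X Y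
    using finite_measure.finite_measure_Union[OF that(1), of "X \<inter> Y" "X - Y"] that(2-)
    by (auto simp: Int_Diff_Un)
  note sF = split[OF F.finite_measure_axioms \<open>sets F = sets M\<close> A B]
    split[OF F.finite_measure_axioms \<open>sets F = sets M\<close> B A]
  note sG = split[OF G.finite_measure_axioms \<open>sets G = sets M\<close> A B]
    split[OF G.finite_measure_axioms \<open>sets G = sets M\<close> B A]
  define d where "d = measure F A - measure F B"
  \<comment> \<open>Since F(B) \<le> 1, k is at least G(B). This trades the additive gain k d for
    G(B) d, in which k no longer occurs.\<close>
  have "measure G B \<le> k * measure F B" using GF B by simp
  also have "\<dots> \<le> k" using k by (simp add: mult_left_le)
  finally have "measure G B * d \<le> k * d"
    using less by (simp add: d_def mult_right_mono)
  also have "k * d = k * measure F (A - B) - k * measure F (B - A)"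
    using sF by (simp add: d_def Int_commute algebra_simps)
  also have "\<dots> \<le> measure G (A - B) - measure G (B - A)"
    using FG[of "A - B"] GF[of "B - A"] A B by (intro diff_mono) auto
  also have "\<dots> = measure G A - measure G B" using sG by (simp add: Int_commute)
  finally show ?thesis by (simp add: d_def algebra_simps)
qed

text \<open>If F(A) exceeded F(B) by d > 0, every G_i(B) would be at most \<beta> / (1 + d). This
  contradicts their supremum being \<beta> unless \<beta> \<le> 0, a case settled by null sets.
  Either hypothesis can later take the role of the family.\<close>

lemma composite_neyman_pearson:
  fixes M :: "'a measure" and f :: "'a \<Rightarrow> real" and g :: "'i \<Rightarrow> 'a \<Rightarrow> real" and \<beta> :: real
  defines "F \<equiv> density M (\<lambda>x. ennreal (f x))"
    and "G \<equiv> (\<lambda>i. density M (\<lambda>x. ennreal (g i x)))"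
  assumes f: "f \<in> borel_measurable M" and g: "\<And>i. i \<in> I \<Longrightarrow> g i \<in> borel_measurable M"
    and fpos: "\<And>x. x \<in> space M \<Longrightarrow> 0 < f x"
    and gpos: "\<And>i x. i \<in> I \<Longrightarrow> x \<in> space M \<Longrightarrow> 0 < g i x"
    and F: "prob_space F" and G: "\<And>i. i \<in> I \<Longrightarrow> prob_space (G i)"
    and A: "A \<in> sets M" and B: "B \<in> sets M"
    and sep: "\<And>i x y. i \<in> I \<Longrightarrow> x \<in> B \<Longrightarrow> y \<in> space M - B \<Longrightarrow> g i x / f x \<le> g i y / f y"
    and size_B: "(SUP i\<in>I. ereal (measure (G i) B)) = ereal \<beta>"
    and size_A: "(SUP i\<in>I. ereal (measure (G i) A)) \<le> ereal \<beta>"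
  shows "measure F A \<le> measure F B"
proof (rule ccontr)
  assume "\<not> ?thesis"
  then have less: "measure F B < measure F A" by simp
  define d where "d = measure F A - measure F B"
  have d: "0 < d" using less by (simp add: d_def)
  \<comment> \<open>An empty supremum is minus infinity in \<open>ereal\<close>, never the real
    \<beta>.\<close>
  have I: "I \<noteq> {}" using size_B by (auto simp: bot_ereal_def)
  then obtain j where j: "j \<in> I" by blast
  have le_A: "measure (G i) A \<le> \<beta>" if "i \<in> I" for i
    using SUP_upper[OF that, of "\<lambda>i. ereal (measure (G i) A)"] size_A
    by (metis ereal_less_eq(3) order_trans)
  have "measure (G i) B \<le> \<beta> / (1 + d)" if i: "i \<in> I" for i
  proof -
    have "measure (G i) B * (1 + d) \<le> measure (G i) A"
      unfolding d_def F_def G_def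
      using less F G[OF i] f g fpos gpos A B sep i
      by (intro neyman_pearson_mult) (auto simp: F_def G_def)
    with le_A[OF i] d show ?thesis by (simp add: field_simps)
  qed
  then have "(SUP i\<in>I. ereal (measure (G i) B)) \<le> ereal (\<beta> / (1 + d))"
    by (intro SUP_least) auto
  then have "\<beta> \<le> \<beta> / (1 + d)" unfolding size_B by simp
  then have "\<beta> * d \<le> 0" using d by (simp add: field_simps)
  then have "\<beta> \<le> 0" using d by (simp add: mult_le_0_iff)
  \<comment> \<open>Here the multiplicative gain is void. But \<open>A\<close> is null for one G_j,
    hence for \<open>M\<close> and for F, so it cannot beat \<open>B\<close> under F.\<close>
  with le_A[OF j] have "measure (G j) A = 0"
    by (meson measure_nonneg order_antisym order_trans)
  then have "A \<in> null_sets M"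
    using measure_density_eq_0_iff[of "g j" M A] g gpos G j A
    by (auto simp: G_def prob_space_def)
  then have "measure F A = 0"
    using measure_density_eq_0_iff[of f M A] f fpos F A
    by (auto simp: F_def prob_space_def)
  with less show False by (simp add: not_less)
qed

text \<open>The function is the cdf of the push-forward \<open>distr P borel T\<close>, and a cdf is
  continuous at every point that carries no mass.\<close>

lemma continuous_measure_le:
  fixes T :: "'a \<Rightarrow> real"
  assumes P: "prob_space P" and T: "T \<in> borel_measurable P"
    and atomless: "\<And>t. measure P {x\<in>space P. T x = t} = 0"
  shows "continuous_on UNIV (\<lambda>c. measure P {x\<in>space P. T x \<le> c})"
proof -
  interpret prob_space P by fact
  interpret D: real_distribution "distr P borel T" using T by simp
  have "measure (distr P borel T) {t} = 0" for t
    using T atomless[of t] by (simp add: measure_distr vimage_def Int_def conj_commute)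
  then have "continuous_on UNIV (cdf (distr P borel T))"
    by (simp add: continuous_on_eq_continuous_at D.isCont_cdf)
  moreover have "cdf (distr P borel T) = (\<lambda>c. measure P {x\<in>space P. T x \<le> c})"
    using T by (simp add: cdf_def measure_distr vimage_def Int_def conj_commute fun_eq_iff)
  ultimately show ?thesis by simp
qed

theorem mainTheorem1:
  fixes S :: "'a::euclidean_space set"
    and \<Theta> H0 H1 :: "real set"
    and \<theta>s \<alpha> \<beta> c0 c1 :: real
    and P :: "real \<Rightarrow> 'a measure"
    and f :: "real \<Rightarrow> 'a \<Rightarrow> real"
    and T :: "'a \<Rightarrow> real"
    and leb :: "'a measure"
  assumes S: "S \<in> sets borel"
    and leb_def: "leb = restrict_space lborel S"
    and H0: "H0 = {\<theta>\<in>\<Theta>. \<theta> \<le> \<theta>s}"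
    and H1: "H1 = \<Theta> - H0"
    and prob: "\<And>\<theta>. \<theta> \<in> \<Theta> \<Longrightarrow> prob_space (P \<theta>)"
    and sets_P: "\<And>\<theta>. \<theta> \<in> \<Theta> \<Longrightarrow> sets (P \<theta>) = sets leb"
    and abs_cont: "\<And>\<theta>. \<theta> \<in> \<Theta> \<Longrightarrow> absolutely_continuous leb (P \<theta>)"
    and f_meas: "\<And>\<theta>. \<theta> \<in> \<Theta> \<Longrightarrow> f \<theta> \<in> borel_measurable leb"
    and f_density: "\<And>\<theta>. \<theta> \<in> \<Theta> \<Longrightarrow> P \<theta> = density leb (\<lambda>x. ennreal (f \<theta> x))"
    and f_pos: "\<And>\<theta> x. \<theta> \<in> \<Theta> \<Longrightarrow> x \<in> S \<Longrightarrow> f \<theta> x > 0"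
    and suff: "sufficient_statistic leb P \<Theta> T"
    and mlr: "monotone_likelihood_ratio S f \<Theta> T"
    and \<alpha>: "\<alpha> \<in> {0..1}"
    and \<beta>: "\<beta> \<in> {0..1}"
    and c0: "(SUP \<theta>1\<in>H1. ereal (measure (P \<theta>1) {x\<in>S. T x \<le> c0})) = ereal \<beta>"
    and c1: "(SUP \<theta>0\<in>H0. ereal (measure (P \<theta>0) {x\<in>S. T x > c1})) = ereal \<alpha>"
  shows "(c0 \<le> c1 \<longrightarrow> UMP_agnostic_test leb P H0 H1 \<alpha> \<beta> (cutoff_test T c0 c1)) \<and>
         (c0 > c1 \<longrightarrow> continuously_distributed P \<Theta> T \<longrightarrow>
           (\<forall>\<phi>. agnostic_test leb \<phi> \<and> has_size P H0 H1 \<alpha> \<beta> \<phi> \<longrightarrow>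
             (\<exists>\<phi>s \<in> {cutoff_test T c c | c. c1 \<le> c \<and> c \<le> c0}. dominates P H0 H1 \<phi>s \<phi>)))"
proof -

  \<comment> \<open>Sample space, likelihood ratios and decision regions\<close>
  have space: "space leb = S" by (simp add: leb_def space_restrict_space)
  have space_P: "space (P \<theta>) = S" if "\<theta> \<in> \<Theta>" for \<theta>
    using sets_eq_imp_space_eq[OF sets_P[OF that]] space by simp
  have T: "T \<in> borel_measurable leb" using suff by (simp add: sufficient_statistic_def)
  have le_sets: "{x\<in>S. T x \<le> c} \<in> sets leb" for c
    using borel_measurable_le[OF T borel_measurable_const, of c] by (simp add: space)
  have gt_sets: "{x\<in>S. T x > c} \<in> sets leb" for c
    using borel_measurable_less[OF borel_measurable_const T, of c] by (simp add: space)
  have \<Theta>: "\<theta> \<in> \<Theta>" if "\<theta> \<in> H0 \<or> \<theta> \<in> H1" for \<theta> using that H0 H1 by auto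
  have less: "\<theta>0 < \<theta>1" if "\<theta>0 \<in> H0" "\<theta>1 \<in> H1" for \<theta>0 \<theta>1
    using that H0 H1 by auto
  \<comment> \<open>This is the separation needed for regions {T \<le> c}, for all pairs of null and
    alternative parameters at once. The reciprocal form \<open>ratio_down\<close> gives it for {T >
    c} with the hypotheses exchanged.\<close>
  have ratio_up: "f \<theta>1 x / f \<theta>0 x \<le> f \<theta>1 y / f \<theta>0 y"
    if "\<theta>0 \<in> H0" "\<theta>1 \<in> H1" "x \<in> S" "y \<in> S" "T x \<le> T y" for \<theta>0 \<theta>1 x y
  proof -
    obtain g where "mono_on (T ` S) g" "\<forall>x\<in>S. f \<theta>1 x / f \<theta>0 x = g (T x)"
      using mlr less \<Theta> \<open>\<theta>0 \<in> H0\<close> \<open>\<theta>1 \<in> H1\<close>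
      unfolding monotone_likelihood_ratio_def by blast
    then show ?thesis using \<open>x \<in> S\<close> \<open>y \<in> S\<close> \<open>T x \<le> T y\<close> by (auto dest: mono_onD)
  qed
  have ratio_down: "f \<theta>0 y / f \<theta>1 y \<le> f \<theta>0 x / f \<theta>1 x"
    if "\<theta>0 \<in> H0" "\<theta>1 \<in> H1" "x \<in> S" "y \<in> S" "T x \<le> T y" for \<theta>0 \<theta>1 x y
  proof -
    have "0 < f \<theta>0 x" "0 < f \<theta>0 y" "0 < f \<theta>1 x" "0 < f \<theta>1 y"
      using f_pos \<Theta> that by auto
    with ratio_up[OF that] show ?thesis by (simp add: field_simps)
  qed
  have prob_density: "prob_space (density leb (\<lambda>x. ennreal (f \<theta> x)))" if "\<theta> \<in> \<Theta>" for \<theta>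
    using prob[OF that] f_density[OF that] by simp
  have decision_sets: "{x\<in>S. \<phi> x = i} \<in> sets leb" if "agnostic_test leb \<phi>" for \<phi> i
    using that borel_measurable_eq[of \<phi> leb "\<lambda>_. i"] by (simp add: agnostic_test_def space)
  have type1: "type1_error P H0 \<phi> = (SUP \<theta>\<in>H0. ereal (measure (P \<theta>) {x\<in>S. \<phi> x = 1}))" for \<phi>
    by (simp add: type1_error_def prob_decision_def space_P \<Theta> cong: SUP_cong_simp)
  have type2: "type2_error P H1 \<phi> = (SUP \<theta>\<in>H1. ereal (measure (P \<theta>) {x\<in>S. \<phi> x = 0}))" for \<phi>
    by (simp add: type2_error_def prob_decision_def space_P \<Theta> cong: SUP_cong_simp)

  \<comment> \<open>Power bounds for tests of the given size\<close>
  have accept: "measure (P \<theta>) {x\<in>S. \<phi> x = 0} \<le> measure (P \<theta>) {x\<in>S. T x \<le> c0}"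
    if \<phi>: "agnostic_test leb \<phi>" "has_size P H0 H1 \<alpha> \<beta> \<phi>" and \<theta>: "\<theta> \<in> H0" for \<phi> \<theta>
  proof -
    \<comment> \<open>The null parameter \<theta> supplies F and the whole alternative is the
      constrained family. The order of \<open>c0\<close> and \<open>c1\<close> does not enter, so
      both parts of the theorem can use the bound.\<close>
    have "measure (density leb (\<lambda>x. ennreal (f \<theta> x))) {x\<in>S. \<phi> x = 0}
        \<le> measure (density leb (\<lambda>x. ennreal (f \<theta> x))) {x\<in>S. T x \<le> c0}"
    proof (rule composite_neyman_pearson[where I = H1 and g = f])
      show "(SUP \<theta>\<in>H1. ereal (measure (density leb (\<lambda>x. ennreal (f \<theta> x))) {x\<in>S. T x \<le> c0}))
          = ereal \<beta>"
        using c0 by (simp add: f_density[symmetric] \<Theta> cong: SUP_cong_simp)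
      show "(SUP \<theta>\<in>H1. ereal (measure (density leb (\<lambda>x. ennreal (f \<theta> x))) {x\<in>S. \<phi> x = 0}))
          \<le> ereal \<beta>"
        using \<phi>(2) by (simp add: has_size_def type2 f_density[symmetric] \<Theta> cong: SUP_cong_simp)
    qed (use \<theta> \<Theta> f_meas f_pos prob_density decision_sets \<phi> le_sets ratio_up in \<open>auto simp: space\<close>)
    then show ?thesis using f_density \<Theta> \<theta> by simp
  qed
  have reject: "measure (P \<theta>) {x\<in>S. \<phi> x = 1} \<le> measure (P \<theta>) {x\<in>S. T x > c1}"
    if \<phi>: "agnostic_test leb \<phi>" "has_size P H0 H1 \<alpha> \<beta> \<phi>" and \<theta>: "\<theta> \<in> H1" for \<phi> \<theta>
  proof -
    \<comment> \<open>The mirror image: \<theta> is an alternative parameter, the null hypothesis is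
      the family, and rejection regions are compared.\<close>
    have "measure (density leb (\<lambda>x. ennreal (f \<theta> x))) {x\<in>S. \<phi> x = 1}
        \<le> measure (density leb (\<lambda>x. ennreal (f \<theta> x))) {x\<in>S. T x > c1}"
    proof (rule composite_neyman_pearson[where I = H0 and g = f])
      show "(SUP \<theta>\<in>H0. ereal (measure (density leb (\<lambda>x. ennreal (f \<theta> x))) {x\<in>S. T x > c1}))
          = ereal \<alpha>"
        using c1 by (simp add: f_density[symmetric] \<Theta> cong: SUP_cong_simp)
      show "(SUP \<theta>\<in>H0. ereal (measure (density leb (\<lambda>x. ennreal (f \<theta> x))) {x\<in>S. \<phi> x = 1}))
          \<le> ereal \<alpha>"
        using \<phi>(2) by (simp add: has_size_def type1 f_density[symmetric] \<Theta> cong: SUP_cong_simp)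
    qed (use \<theta> \<Theta> f_meas f_pos prob_density decision_sets \<phi> gt_sets ratio_down in \<open>auto simp: space\<close>)
    then show ?thesis using f_density \<Theta> \<theta> by simp
  qed

  \<comment> \<open>Decision regions and domination of cutoff tests\<close>
  have cutoff_0: "{x\<in>S. cutoff_test T c d x = 0} = {x\<in>S. T x \<le> c}" for c d
    by (auto simp: cutoff_test_def)
  \<comment> \<open>Acceptance is tried first, so with d < c the points with d < T \<le> c would be
    accepted, not rejected.\<close>
  have cutoff_1: "{x\<in>S. cutoff_test T c d x = 1} = {x\<in>S. T x > d}" if "c \<le> d" for c d
    using that by (auto simp: cutoff_test_def)
  have dominatesI: "dominates P H0 H1 (cutoff_test T c d) \<phi>"
    if "c \<le> d"
      and "\<And>\<theta>. \<theta> \<in> H0 \<Longrightarrow> measure (P \<theta>) {x\<in>S. \<phi> x = 0} \<le> measure (P \<theta>) {x\<in>S. T x \<le> c}"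
      and "\<And>\<theta>. \<theta> \<in> H1 \<Longrightarrow> measure (P \<theta>) {x\<in>S. \<phi> x = 1} \<le> measure (P \<theta>) {x\<in>S. T x > d}"
    for c d \<phi>
    using that H1
    by (auto simp: dominates_def power_fun_def prob_decision_def space_P \<Theta> cutoff_0 cutoff_1)
  show ?thesis
  proof (intro conjI impI allI)
    assume le: "c0 \<le> c1"
    have "agnostic_test leb (cutoff_test T c0 c1)"
      using T unfolding agnostic_test_def cutoff_test_def[abs_def] by auto
    moreover have "has_level P H0 H1 \<alpha> \<beta> (cutoff_test T c0 c1)"
      using c0 c1 le by (simp add: has_level_def type1 type2 cutoff_0 cutoff_1)
    ultimately show "UMP_agnostic_test leb P H0 H1 \<alpha> \<beta> (cutoff_test T c0 c1)"
      using le accept reject by (auto simp: UMP_agnostic_test_def intro!: dominatesI)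
  next
    fix \<phi>
    assume gt: "c0 > c1" and cont: "continuously_distributed P \<Theta> T"
      and \<phi>': "agnostic_test leb \<phi> \<and> has_size P H0 H1 \<alpha> \<beta> \<phi>"
    then have \<phi>: "agnostic_test leb \<phi>" "has_size P H0 H1 \<alpha> \<beta> \<phi>" by auto

    \<comment> \<open>Crossing cutoffs: a single cutoff by connectedness\<close>
    define A where "A = {x\<in>S. \<phi> x = 0}"
    define R where "R = {x\<in>S. \<phi> x = 1}"
    have A: "A \<in> sets leb" and R: "R \<in> sets leb"
      using decision_sets \<phi> by (auto simp: A_def R_def)
    have compl: "measure (P \<theta>) {x\<in>S. T x > c} = 1 - measure (P \<theta>) {x\<in>S. T x \<le> c}"
      if "\<theta> \<in> \<Theta>" for \<theta> c
    proof -
      have "{x\<in>S. T x > c} = space (P \<theta>) - {x\<in>S. T x \<le> c}" using space_P[OF that] by auto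
      then show ?thesis
        using prob_space.prob_compl[OF prob[OF that], of "{x\<in>S. T x \<le> c}"] le_sets sets_P[OF that]
        by simp
    qed
    have disj: "measure (P \<theta>) R \<le> 1 - measure (P \<theta>) A" if "\<theta> \<in> \<Theta>" for \<theta>
    proof -
      interpret prob_space "P \<theta>" using prob that by simp
      have "measure (P \<theta>) R \<le> measure (P \<theta>) (space (P \<theta>) - A)"
        using A sets_P[OF that] space_P[OF that]
        by (intro finite_measure_mono) (auto simp: A_def R_def)
      then show ?thesis using prob_compl[of A] A sets_P[OF that] by simp
    qed
    have cont_on: "continuous_on UNIV (\<lambda>c. measure (P \<theta>) {x\<in>S. T x \<le> c})" if "\<theta> \<in> \<Theta>" for \<theta>
    proof -
      have "T \<in> borel_measurable (P \<theta>)"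
        using T measurable_cong_sets[OF sets_P[OF that] refl, of borel] by blast
      then show ?thesis
        using continuous_measure_le[OF prob[OF that], of T] cont that
        by (simp add: continuously_distributed_def space_P)
    qed
    define C0 where "C0 = (\<Inter>\<theta>\<in>H0. {c. measure (P \<theta>) A \<le> measure (P \<theta>) {x\<in>S. T x \<le> c}})"
    \<comment> \<open>The requirement that {T > c} be as probable as \<open>R\<close> is put through
      complements, so that \<open>C1\<close>, like \<open>C0\<close>, is cut out by the continuous
      cdf of T.\<close>
    define C1 where "C1 = (\<Inter>\<theta>\<in>H1. {c. measure (P \<theta>) {x\<in>S. T x \<le> c} \<le> 1 - measure (P \<theta>) R})"
    have "closed C0" "closed C1"
      unfolding C0_def C1_def
      by (auto intro!: closed_INT closed_Collect_le continuous_on_const cont_on \<Theta>)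
    moreover have "c0 \<in> C0" using accept \<phi> by (auto simp: C0_def A_def)
    moreover have "c1 \<in> C1"
    proof -
      have "measure (P \<theta>) {x\<in>S. T x \<le> c1} \<le> 1 - measure (P \<theta>) R" if "\<theta> \<in> H1" for \<theta>
        using reject[OF \<phi> that] compl[of \<theta> c1] that \<Theta> by (simp add: R_def)
      then show ?thesis by (simp add: C1_def)
    qed
    \<comment> \<open>Failure of c at a single null parameter already forces c into
      \<open>C1\<close>: under every alternative, {T \<le> c} is then at most as probable as
      \<open>A\<close>, and \<open>A\<close> is disjoint from \<open>R\<close>. The factor 1 + d is
      simply dropped.\<close>
    moreover have "c \<in> C0 \<union> C1" for c
    proof (cases "c \<in> C0")
      case False
      then obtain \<theta>0 where \<theta>0: "\<theta>0 \<in> H0"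
        and lt: "measure (P \<theta>0) {x\<in>S. T x \<le> c} < measure (P \<theta>0) A"
        by (auto simp: C0_def not_le)
      have "measure (P \<theta>1) {x\<in>S. T x \<le> c} \<le> 1 - measure (P \<theta>1) R" if \<theta>1: "\<theta>1 \<in> H1" for \<theta>1
      proof -
        let ?d = "measure (P \<theta>0) A - measure (P \<theta>0) {x\<in>S. T x \<le> c}"
        have "measure (P \<theta>1) {x\<in>S. T x \<le> c} \<le> measure (P \<theta>1) {x\<in>S. T x \<le> c} * (1 + ?d)"
          using lt by (simp add: mult_le_cancel_left1)
        also have "\<dots> \<le> measure (P \<theta>1) A"
          unfolding f_density[OF \<Theta>, OF disjI1, OF \<theta>0] f_density[OF \<Theta>, OF disjI2, OF \<theta>1]
        proof (rule neyman_pearson_mult)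
          show "f \<theta>1 x / f \<theta>0 x \<le> f \<theta>1 y / f \<theta>0 y"
            if "x \<in> {x\<in>S. T x \<le> c}" "y \<in> space leb - {x\<in>S. T x \<le> c}" for x y
            using that \<theta>0 \<theta>1 by (intro ratio_up) (auto simp: space)
        qed (use \<theta>0 \<theta>1 \<Theta> f_meas f_pos prob_density A le_sets lt in
               \<open>auto simp: space f_density[symmetric]\<close>)
        finally show ?thesis using disj[of \<theta>1] \<theta>1 \<Theta> by simp
      qed
      then show ?thesis by (simp add: C1_def)
    qed simp
    \<comment> \<open>Otherwise \<open>C0\<close> and \<open>C1\<close> would split the interval
      into two disjoint relatively closed pieces, nonempty because they contain \<open>c0\<close>
      and \<open>c1\<close> respectively.\<close>
    ultimately have "C0 \<inter> C1 \<inter> {c1..c0} \<noteq> {}"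
      using connected_closedD[of "{c1..c0}" C0 C1] gt by fastforce
    then obtain c where c: "c \<in> C0" "c \<in> C1" "c1 \<le> c" "c \<le> c0" by auto
    have "dominates P H0 H1 (cutoff_test T c c) \<phi>"
      using c(1,2) \<Theta>
      by (intro dominatesI) (auto simp: C0_def C1_def A_def R_def compl le_diff_eq algebra_simps)
    with c(3,4) show "\<exists>\<phi>s \<in> {cutoff_test T c c | c. c1 \<le> c \<and> c \<le> c0}. dominates P H0 H1 \<phi>s \<phi>"
      by auto
  qed
qed

end
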